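(* Let $n\ge 1$ be an integer, $\mathcal{V}=\{1,\ldots,n\}$, let $r_i\in(0,1]$ for $i\in\mathcal{V}$, and let $r=\min_{i\in\mathcal{V}}r_i$. Let $x(t)=(x_1(t),\ldots,x_n(t))$, $t=0,1,2,\ldots$, be the trajectory of the heterogeneous Hegselmann-Krause system with confidence bounds $r_1,\ldots,r_n$ started from initial opinions $x(0)\in[0,1]^n$. If $x_{\max}(0)-x_{\min}(0)\le 2r$, where $x_{\max}(0)=\max_{i\in\mathcal{V}}x_i(0)$ and $x_{\min}(0)=\min_{i\in\mathcal{V}}x_i(0)$, then the system converges in finite time.
   Context: Heterogeneous Hegselmann-Krause (HK) system: there are $n$ agents $\mathcal{V}=\{1,\ldots,n\}$; agent $i$ has confidence bound $r_i\in(0,1]$ and opinion $x_i(t)\in[0,1]$ at integer time $t\ge 0$. Given $x(0)\in[0,1]^n$, the opinions evolve synchronously by $$x_i(t+1)=\frac{1}{|\mathcal{N}_i(x(t))|}\sum_{j\in\mathcal{N}_i(x(t))}x_j(t),\qquad i\in\mathcal{V},$$ where $\mathcal{N}_i(x(t))=\{1\le j\le n : |x_j(t)-x_i(t)|\le r_i\}$ (so $i\in\mathcal{N}_i(x(t))$). The opinion $x_i(t)$ of agent $i$ converges in finite time if there exist $x_i^*\in[0,1]$ and a time $T\ge 0$ such that $x_i(t)=x_i^*$ for all $t\ge T$. The system converges in finite time if the opinion of every agent $i\in\mathcal{V}$ converges in finite time. *)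

theory Defs
  imports Complex_Main
begin

text \<open>
  The agents are the elements of \<open>{1..n}\<close>. An opinion profile is a function
  \<open>nat \<Rightarrow> real\<close> of which only the values on \<open>{1..n}\<close> matter, and \<open>x t i\<close> is the
  opinion of agent \<open>i\<close> at time \<open>t\<close>.
\<close>

definition hk_neighbours :: "nat \<Rightarrow> (nat \<Rightarrow> real) \<Rightarrow> (nat \<Rightarrow> real) \<Rightarrow> nat \<Rightarrow> nat set" where
  "hk_neighbours n r y i = {j \<in> {1..n}. \<bar>y j - y i\<bar> \<le> r i}"

text \<open>The initial profile \<open>x 0\<close> is not constrained by this predicate; it determines
  the later opinions of all agents in \<open>{1..n}\<close>.\<close>

definition hk_trajectory :: "nat \<Rightarrow> (nat \<Rightarrow> real) \<Rightarrow> (nat \<Rightarrow> nat \<Rightarrow> real) \<Rightarrow> bool" where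
  "hk_trajectory n r x \<longleftrightarrow>
     (\<forall>t. \<forall>i\<in>{1..n}.
        x (Suc t) i =
          1 / real (card (hk_neighbours n r (x t) i)) * (\<Sum>j\<in>hk_neighbours n r (x t) i. x t j))"

definition agent_converges_finite_time :: "(nat \<Rightarrow> nat \<Rightarrow> real) \<Rightarrow> nat \<Rightarrow> bool" where
  "agent_converges_finite_time x i \<longleftrightarrow>
     (\<exists>l. 0 \<le> l \<and> l \<le> 1 \<and> (\<exists>T. \<forall>t\<ge>T. x t i = l))"

definition system_converges_finite_time :: "nat \<Rightarrow> (nat \<Rightarrow> nat \<Rightarrow> real) \<Rightarrow> bool" where
  "system_converges_finite_time n x \<longleftrightarrow> (\<forall>i\<in>{1..n}. agent_converges_finite_time x i)"

end

theory Submission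
  imports Defs
begin

text \<open>
  Let \<open>\<rho>\<close> be the smallest confidence bound and \<open>D t\<close> the diameter of the profile at time \<open>t\<close>.
  Averaging never enlarges the diameter, so \<open>D\<close> converges and its drop in one step is eventually
  at most any prescribed \<open>c > 0\<close>. If \<open>D t \<le> \<rho>\<close> at some time, everybody hears everybody and the
  next profile is a consensus. Suppose from now on that \<open>D t > \<rho>\<close> for all \<open>t\<close>.

  An agent that hears an opinion at distance \<open>s\<close> below the maximum is pulled down to distance at
  least \<open>s / n\<close> below it. If the maximum drops by at most \<open>c\<close>, the agent that attains the new
  maximum therefore hears nothing that is more than \<open>n * c\<close> below the old one; as it hears at
  least \<open>\<rho>\<close> far, no opinion is between \<open>\<rho>\<close> and \<open>n * c\<close> below the maximum
  (\<open>no_opinion_just_below_top\<close>). The same holds above the minimum. Since \<open>D t \<le> 2 * \<rho>\<close>, these two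
  gaps leave only opinions within \<open>n * c\<close> of an extreme
  (\<open>polarized_if_extremes_move_little\<close>).

  So from some time on the profile consists of two narrow clusters at its extremes. An agent that
  hears both of them would move to a point far from both extremes
  (\<open>no_hearing_across\<close>), where no opinion can be at the next time. Hence
  the clusters ignore each other; each of them merges into a single opinion in one step, and the
  resulting profile is a fixed point (\<open>frozen_after_merge\<close>).
\<close>

section \<open>Averages that include an outlier\<close>

text \<open>
  One member that lies below the upper bound pulls the average down by at least a fixed fraction
  of its deficit, because the other members cannot compensate. Both the gaps next to the extremes
  and the mutual isolation of the clusters come from this.
\<close>

lemma mean_le_bound_minus_deficit:
  fixes y :: "'a \<Rightarrow> real"
  assumes "finite S" and "k \<in> S" and "card S \<le> n" and "\<And>j. j \<in> S \<Longrightarrow> y j \<le> b"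
  shows "1 / real (card S) * sum y S \<le> b - (b - y k) / real n"
proof -
  have pos: "real (card S) > 0"
    using assms(1,2) card_gt_0_iff by fastforce
  have "b - y k \<le> (\<Sum>j\<in>S. b - y j)"
    using assms by (intro member_le_sum[of k S "\<lambda>j. b - y j"]) auto
  also have "\<dots> = real (card S) * b - sum y S"
    by (simp add: sum_subtractf)
  finally have "(b - y k) / real (card S) \<le> (real (card S) * b - sum y S) / real (card S)"
    using pos by (simp add: divide_right_mono)
  also have "\<dots> = b - 1 / real (card S) * sum y S"
    using pos by (simp add: field_simps)
  finally have "(b - y k) / real (card S) \<le> b - 1 / real (card S) * sum y S" .
  moreover have "(b - y k) / real n \<le> (b - y k) / real (card S)"
    using assms pos by (intro divide_left_mono) auto
  ultimately show ?thesis by linarith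
qed

section \<open>One step of the dynamics\<close>

definition hk_update :: "nat \<Rightarrow> (nat \<Rightarrow> real) \<Rightarrow> (nat \<Rightarrow> real) \<Rightarrow> nat \<Rightarrow> real" where
  "hk_update n r y i =
     1 / real (card (hk_neighbours n r y i)) * (\<Sum>j\<in>hk_neighbours n r y i. y j)"

lemma hk_trajectory_Suc:
  assumes "hk_trajectory n r x" and "i \<in> {1..n}"
  shows "x (Suc t) i = hk_update n r (x t) i"
  using assms by (auto simp: hk_trajectory_def hk_update_def)

lemma finite_hk_neighbours: "finite (hk_neighbours n r y i)"
  by (simp add: hk_neighbours_def)

lemma hk_neighbours_subset: "hk_neighbours n r y i \<subseteq> {1..n}"
  by (auto simp: hk_neighbours_def)

lemma card_hk_neighbours_le: "card (hk_neighbours n r y i) \<le> n"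
  using card_mono[OF _ hk_neighbours_subset] by fastforce

lemma self_in_hk_neighbours: "i \<in> {1..n} \<Longrightarrow> 0 < r i \<Longrightarrow> i \<in> hk_neighbours n r y i"
  by (simp add: hk_neighbours_def)

text \<open>The dynamics commutes with reflection, so statements about the bottom of a profile follow
  from those about its top.\<close>

lemma hk_neighbours_uminus: "hk_neighbours n r (\<lambda>j. - y j) i = hk_neighbours n r y i"
  by (auto simp: hk_neighbours_def)

lemma hk_update_uminus: "hk_update n r (\<lambda>j. - y j) i = - hk_update n r y i"
  by (simp add: hk_update_def hk_neighbours_uminus sum_negf)

lemma hk_update_le:
  assumes "\<And>j. j \<in> {1..n} \<Longrightarrow> y j \<le> b" and "k \<in> hk_neighbours n r y i"
  shows "hk_update n r y i \<le> b - (b - y k) / real n"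
  unfolding hk_update_def
  using assms hk_neighbours_subset
  by (intro mean_le_bound_minus_deficit finite_hk_neighbours card_hk_neighbours_le) blast+

lemma hk_update_ge:
  assumes "\<And>j. j \<in> {1..n} \<Longrightarrow> a \<le> y j" and "k \<in> hk_neighbours n r y i"
  shows "a + (y k - a) / real n \<le> hk_update n r y i"
  using hk_update_le[of n "\<lambda>j. - y j" "- a" k r i] assms
  by (simp add: hk_neighbours_uminus hk_update_uminus diff_divide_distrib)

lemma hk_update_between:
  assumes "\<And>j. j \<in> hk_neighbours n r y i \<Longrightarrow> a \<le> y j \<and> y j \<le> b"
    and "k \<in> hk_neighbours n r y i"
  shows "a \<le> hk_update n r y i" and "hk_update n r y i \<le> b"
proof -
  let ?N = "hk_neighbours n r y i"
  have pos: "real (card ?N) > 0"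
    using assms(2) finite_hk_neighbours card_gt_0_iff by fastforce
  have "real (card ?N) * a \<le> sum y ?N" and "sum y ?N \<le> real (card ?N) * b"
    using assms(1) sum_bounded_below[of ?N a y] sum_bounded_above[of ?N y b] by auto
  with pos show "a \<le> hk_update n r y i" and "hk_update n r y i \<le> b"
    by (simp_all add: hk_update_def field_simps)
qed

lemma hk_update_eq_if_neighbours_agree:
  assumes "\<And>j. j \<in> hk_neighbours n r y i \<Longrightarrow> y j = v" and "k \<in> hk_neighbours n r y i"
  shows "hk_update n r y i = v"
  using hk_update_between[of n r y i v v k] assms by fastforce

section \<open>Polarized profiles\<close>

definition polarized :: "nat \<Rightarrow> real \<Rightarrow> real \<Rightarrow> real \<Rightarrow> (nat \<Rightarrow> real) \<Rightarrow> bool" where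
  "polarized n a b d y \<longleftrightarrow>
     (\<forall>j\<in>{1..n}. a \<le> y j \<and> y j \<le> b \<and> (y j \<le> a + d \<or> b - d \<le> y j))"

text \<open>
  The agent \<open>i\<close> stays near the top although it hears everything within \<open>\<rho>\<close> of itself; whatever it
  hears must therefore be near the top, in particular its own opinion.
\<close>

lemma no_opinion_just_below_top:
  assumes ub: "\<And>j. j \<in> {1..n} \<Longrightarrow> y j \<le> b"
    and i: "i \<in> {1..n}" "0 < r i" "\<rho> \<le> r i" "b - c \<le> hk_update n r y i"
    and j: "j \<in> {1..n}"
  shows "y j < b - \<rho> \<or> b - real n * c \<le> y j"
proof (rule ccontr)
  assume "\<not> ?thesis"
  then have yj: "b - \<rho> \<le> y j" "y j < b - real n * c" by auto
  have n: "real n > 0" using i by simp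
  have near_top: "b - real n * c \<le> y k" if "k \<in> hk_neighbours n r y i" for k
  proof -
    have "(b - y k) / real n \<le> c"
      using hk_update_le[of n y b k r i, OF ub that] i(4) by linarith
    with n show ?thesis by (simp add: field_simps)
  qed
  have "b - real n * c \<le> y i"
    using near_top self_in_hk_neighbours i by blast
  with yj ub[OF i(1)] i(3) have "\<bar>y j - y i\<bar> \<le> r i" by linarith
  with j have "j \<in> hk_neighbours n r y i" by (simp add: hk_neighbours_def)
  with near_top yj show False by fastforce
qed

lemma no_opinion_just_above_bottom:
  assumes "\<And>j. j \<in> {1..n} \<Longrightarrow> a \<le> y j"
    and "i \<in> {1..n}" "0 < r i" "\<rho> \<le> r i" "hk_update n r y i \<le> a + c"
    and "j \<in> {1..n}"
  shows "a + \<rho> < y j \<or> y j \<le> a + real n * c"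
  using no_opinion_just_below_top[of n "\<lambda>j. - y j" "- a" i r \<rho> c j] assms
  by (auto simp: hk_update_uminus)

text \<open>
  This is where a diameter of at most \<open>2 * \<rho>\<close> matters: the gap below the top and the gap above the
  bottom then overlap or touch, so that nothing remains in the middle.
\<close>

lemma polarized_if_extremes_move_little:
  assumes bounds: "\<And>j. j \<in> {1..n} \<Longrightarrow> a \<le> y j \<and> y j \<le> b"
    and r: "\<And>j. j \<in> {1..n} \<Longrightarrow> 0 < r j \<and> \<rho> \<le> r j"
    and diam: "b - a \<le> 2 * \<rho>"
    and k: "k \<in> {1..n}" "b - c \<le> hk_update n r y k"
    and l: "l \<in> {1..n}" "hk_update n r y l \<le> a + c"
  shows "polarized n a b (real n * c) y"
  unfolding polarized_def
proof
  fix j assume j: "j \<in> {1..n}"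
  have "y j < b - \<rho> \<or> b - real n * c \<le> y j"
    using no_opinion_just_below_top[of n y b k r \<rho> c j] bounds r k j by blast
  moreover have "a + \<rho> < y j \<or> y j \<le> a + real n * c"
    using no_opinion_just_above_bottom[of n a y l r \<rho> c j] bounds r l j by blast
  ultimately show "a \<le> y j \<and> y j \<le> b \<and> (y j \<le> a + real n * c \<or> b - real n * c \<le> y j)"
    using bounds[OF j] diam by linarith
qed

text \<open>
  An agent that hears both clusters ends up at least \<open>(b - a - d) / n\<close> away from each extreme, while
  the extremes of the next profile have moved by at most \<open>c\<close> and are surrounded by clusters of
  width \<open>d\<close>. For this reason the diameter has to exceed \<open>d + n * (c + d)\<close>.
\<close>

lemma no_hearing_across:
  assumes pol: "polarized n a b d y"
    and next_pol: "polarized n a' b' d (hk_update n r y)"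
    and move: "a' \<le> a + c" "b - c \<le> b'"
    and diam: "d + real n * (c + d) < b - a"
    and i: "i \<in> {1..n}"
    and k: "k \<in> hk_neighbours n r y i" "y k \<le> a + d"
    and l: "l \<in> hk_neighbours n r y i" "b - d \<le> y l"
  shows False
proof -
  have n: "real n > 0" using i by simp
  have bounds: "a \<le> y j" "y j \<le> b" if "j \<in> {1..n}" for j
    using pol that by (auto simp: polarized_def)
  have "real n * (c + d) < y l - a" "real n * (c + d) < b - y k"
    using k(2) l(2) diam by linarith+
  then have "c + d < (y l - a) / real n" "c + d < (b - y k) / real n"
    using n by (simp_all add: field_simps)
  moreover have "a + (y l - a) / real n \<le> hk_update n r y i"
    using hk_update_ge[of n a y l r i] bounds l by blast
  moreover have "hk_update n r y i \<le> b - (b - y k) / real n"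
    using hk_update_le[of n y b k r i] bounds k by blast
  moreover have "hk_update n r y i \<le> a' + d \<or> b' - d \<le> hk_update n r y i"
    using next_pol i by (auto simp: polarized_def)
  ultimately show False using move by linarith
qed

section \<open>Isolated clusters freeze\<close>

text \<open>
  A profile in which confidence reaches exactly as far as a common width \<open>d\<close>, although the
  individual bounds differ. Then hearing one another is symmetric in spite of the heterogeneity.
\<close>

definition hears_within :: "nat \<Rightarrow> (nat \<Rightarrow> real) \<Rightarrow> real \<Rightarrow> (nat \<Rightarrow> real) \<Rightarrow> bool" where
  "hears_within n r d y \<longleftrightarrow>
     (\<forall>i\<in>{1..n}. \<forall>j\<in>{1..n}. \<bar>y j - y i\<bar> \<le> r i \<longleftrightarrow> \<bar>y j - y i\<bar> \<le> d)"

lemma hears_within_if_polarized: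
  assumes pol: "polarized n a b d y"
    and next_pol: "polarized n a' b' d (hk_update n r y)"
    and move: "a' \<le> a + c" "b - c \<le> b'"
    and diam: "d + real n * (c + d) < b - a"
    and r: "\<And>j. j \<in> {1..n} \<Longrightarrow> 0 < r j \<and> d \<le> r j"
  shows "hears_within n r d y"
  unfolding hears_within_def
proof (intro ballI iffI)
  fix i j assume i: "i \<in> {1..n}" and j: "j \<in> {1..n}"
  { assume "\<bar>y j - y i\<bar> \<le> d"
    with r[OF i] show "\<bar>y j - y i\<bar> \<le> r i" by linarith }
  assume "\<bar>y j - y i\<bar> \<le> r i"
  then have N: "j \<in> hk_neighbours n r y i" "i \<in> hk_neighbours n r y i"
    using i j r[OF i] by (auto simp: hk_neighbours_def)
  note across = no_hearing_across[OF pol next_pol move diam i]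
  have "\<not> (y i \<le> a + d \<and> b - d \<le> y j)" "\<not> (y j \<le> a + d \<and> b - d \<le> y i)"
    using across N by blast+
  moreover have "a \<le> y i \<and> y i \<le> b \<and> (y i \<le> a + d \<or> b - d \<le> y i)"
    "a \<le> y j \<and> y j \<le> b \<and> (y j \<le> a + d \<or> b - d \<le> y j)"
    using pol i j by (auto simp: polarized_def)
  ultimately show "\<bar>y j - y i\<bar> \<le> d" by argo
qed

text \<open>
  Members of one cluster have the same neighbours, hence merge in the first step. Opinions of
  different clusters stay more than \<open>d\<close> apart, so in the second profile an agent hears only
  opinions equal to its own.
\<close>

lemma frozen_after_merge:
  assumes pol: "polarized n a b d y"
    and diam: "3 * d < b - a"
    and within: "hears_within n r d y" "hears_within n r d (hk_update n r y)"
    and r: "\<And>j. j \<in> {1..n} \<Longrightarrow> 0 < r j"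
    and i: "i \<in> {1..n}" and j: "j \<in> hk_neighbours n r (hk_update n r y) i"
  shows "hk_update n r y j = hk_update n r y i"
proof -
  let ?z = "hk_update n r y"
  have j': "j \<in> {1..n}" using j hk_neighbours_subset by blast
  have cluster: "a \<le> y k \<and> y k \<le> b \<and> (y k \<le> a + d \<or> b - d \<le> y k)" if "k \<in> {1..n}" for k
    using pol that by (auto simp: polarized_def)
  have nbr: "k \<in> hk_neighbours n r y l \<longleftrightarrow> k \<in> {1..n} \<and> \<bar>y k - y l\<bar> \<le> d"
    if "l \<in> {1..n}" for k l
    using within(1) that by (auto simp: hears_within_def hk_neighbours_def)
  have self: "k \<in> hk_neighbours n r y k" if "k \<in> {1..n}" for k
    using self_in_hk_neighbours that r by blast
  have low: "?z k \<le> a + d" if k: "k \<in> {1..n}" "y k \<le> a + d" for k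
  proof (rule hk_update_between(2)[OF _ self[OF k(1)]])
    fix l assume "l \<in> hk_neighbours n r y k"
    with nbr[OF k(1)] have "l \<in> {1..n}" "\<bar>y l - y k\<bar> \<le> d" by auto
    with cluster[of l] k(2) diam show "a \<le> y l \<and> y l \<le> a + d" by argo
  qed
  have high: "b - d \<le> ?z k" if k: "k \<in> {1..n}" "b - d \<le> y k" for k
  proof (rule hk_update_between(1)[OF _ self[OF k(1)]])
    fix l assume "l \<in> hk_neighbours n r y k"
    with nbr[OF k(1)] have "l \<in> {1..n}" "\<bar>y l - y k\<bar> \<le> d" by auto
    with cluster[of l] k(2) diam show "b - d \<le> y l \<and> y l \<le> b" by argo
  qed
  have "\<bar>?z j - ?z i\<bar> \<le> d"
    using within(2) i j j' by (auto simp: hears_within_def hk_neighbours_def)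
  then have "\<not> (?z i \<le> a + d \<and> b - d \<le> ?z j)" "\<not> (?z j \<le> a + d \<and> b - d \<le> ?z i)"
    using diam by linarith+
  then have same: "y i \<le> a + d \<and> y j \<le> a + d \<or> b - d \<le> y i \<and> b - d \<le> y j"
    using low high cluster i j' by meson
  have "\<bar>y k - y i\<bar> \<le> d \<longleftrightarrow> \<bar>y k - y j\<bar> \<le> d" if "k \<in> {1..n}" for k
    using same cluster[OF that] cluster[OF i] cluster[OF j'] diam by argo
  then have "hk_neighbours n r y j = hk_neighbours n r y i"
    using nbr[OF i] nbr[OF j'] by blast
  then show ?thesis by (simp add: hk_update_def)
qed

lemma system_converges_if_frozen:
  assumes traj: "hk_trajectory n r x"
    and r: "\<And>i. i \<in> {1..n} \<Longrightarrow> 0 < r i"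
    and unit: "\<And>i. i \<in> {1..n} \<Longrightarrow> 0 \<le> x T i \<and> x T i \<le> 1"
    and frozen: "\<And>i j. i \<in> {1..n} \<Longrightarrow> j \<in> hk_neighbours n r (x T) i \<Longrightarrow> x T j = x T i"
  shows "system_converges_finite_time n x"
proof -
  have const: "\<forall>i\<in>{1..n}. x (T + s) i = x T i" for s
  proof (induction s)
    case (Suc s)
    show ?case
    proof
      fix i assume i: "i \<in> {1..n}"
      have nbr: "hk_neighbours n r (x (T + s)) i = hk_neighbours n r (x T) i"
        using Suc i by (auto simp: hk_neighbours_def)
      have "hk_update n r (x (T + s)) i = x T i"
      proof (rule hk_update_eq_if_neighbours_agree)
        show "i \<in> hk_neighbours n r (x (T + s)) i"
          using self_in_hk_neighbours i r by blast
        fix j assume "j \<in> hk_neighbours n r (x (T + s)) i"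
        then have "j \<in> hk_neighbours n r (x T) i" "j \<in> {1..n}"
          using nbr hk_neighbours_subset by blast+
        then show "x (T + s) j = x T i"
          using Suc frozen[OF i] by simp
      qed
      then show "x (T + Suc s) i = x T i"
        using hk_trajectory_Suc[OF traj i] by simp
    qed
  qed simp
  have "x t i = x T i" if "i \<in> {1..n}" "T \<le> t" for i t
    using const[of "t - T"] that by simp
  then show ?thesis
    using unit unfolding system_converges_finite_time_def agent_converges_finite_time_def by blast
qed

section \<open>The diameter along a trajectory\<close>

lemma decreasing_nonneg_eventually_small_drop:
  fixes D :: "nat \<Rightarrow> real"
  assumes "decseq D" and "\<And>t. 0 \<le> D t" and "0 < c"
  shows "\<exists>T. \<forall>t\<ge>T. D t - D (Suc t) \<le> c"
proof -
  obtain L where L: "D \<longlonglongrightarrow> L"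
    using decseq_convergent[OF assms(1), of 0] assms(2) by blast
  then have "(\<lambda>t. D t - D (Suc t)) \<longlonglongrightarrow> L - L"
    by (intro tendsto_diff LIMSEQ_Suc)
  then have "eventually (\<lambda>t. D t - D (Suc t) < c) sequentially"
    using order_tendstoD(2)[of _ "L - L" sequentially c] assms(3) by simp
  then show ?thesis
    by (auto simp: eventually_sequentially intro: less_imp_le)
qed

theorem corollary3p2:
  fixes n :: nat and r :: "nat \<Rightarrow> real" and x :: "nat \<Rightarrow> nat \<Rightarrow> real"
  assumes "n \<ge> 1"
    and "\<And>i. i \<in> {1..n} \<Longrightarrow> 0 < r i \<and> r i \<le> 1"
    and "\<And>i. i \<in> {1..n} \<Longrightarrow> 0 \<le> x 0 i \<and> x 0 i \<le> 1"
    and "hk_trajectory n r x"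
    and "Max (x 0 ` {1..n}) - Min (x 0 ` {1..n}) \<le> 2 * Min (r ` {1..n})"
  shows "system_converges_finite_time n x"
proof -
  note step = hk_trajectory_Suc[OF assms(4)]
  define \<rho> where "\<rho> = Min (r ` {1..n})"
  define a where "a t = Min (x t ` {1..n})" for t
  define b where "b t = Max (x t ` {1..n})" for t
  define D where "D t = b t - a t" for t
  have ne: "{1..n} \<noteq> {}" using assms(1) by simp
  have "\<rho> \<in> r ` {1..n}" using ne by (simp add: \<rho>_def)
  then have \<rho>_pos: "0 < \<rho>" using assms(2) by auto
  have r: "0 < r i \<and> \<rho> \<le> r i" if "i \<in> {1..n}" for i
    using that assms(2) by (simp add: \<rho>_def)
  have self: "i \<in> hk_neighbours n r (x t) i" if "i \<in> {1..n}" for i t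
    using self_in_hk_neighbours that r by blast
  have bounds: "a t \<le> x t i \<and> x t i \<le> b t" if "i \<in> {1..n}" for t i
    using that by (simp add: a_def b_def)
  have "b t \<in> x t ` {1..n}" "a t \<in> x t ` {1..n}" for t
    using ne by (simp_all add: a_def b_def)
  then have attained: "\<exists>k\<in>{1..n}. x t k = b t" "\<exists>l\<in>{1..n}. x t l = a t" for t
    by (metis imageE)+
  have next_bounds: "a t \<le> x (Suc t) i" "x (Suc t) i \<le> b t" if "i \<in> {1..n}" for t i
    using hk_update_between[of n r "x t" i "a t" "b t" i] bounds self[OF that] step[OF that]
      hk_neighbours_subset by (metis subsetD)+
  have mono: "a t \<le> a (Suc t)" "b (Suc t) \<le> b t" for t
    using attained[of "Suc t"] next_bounds by metis+
  have unit: "0 \<le> x t i \<and> x t i \<le> 1" if "i \<in> {1..n}" for t i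
  proof -
    have "a 0 \<le> a t" "b t \<le> b 0"
      using mono by (auto intro: lift_Suc_mono_le lift_Suc_antimono_le)
    moreover have "0 \<le> a 0" "b 0 \<le> 1"
      using assms(3) attained[of 0] by metis+
    ultimately show ?thesis using bounds[OF that, of t] by linarith
  qed
  have dec: "decseq D"
    using mono by (intro decseq_SucI) (auto simp: D_def intro: diff_mono)
  have D_nonneg: "0 \<le> D t" for t
    using bounds[of 1 t] assms(1) by (simp add: D_def)
  have D_le: "D t \<le> 2 * \<rho>" for t
    using decseqD[OF dec, of 0 t] assms(5) by (simp add: D_def a_def b_def \<rho>_def)
  show ?thesis
  proof (cases "\<exists>t. D t \<le> \<rho>")
    case True
    then obtain t where t: "D t \<le> \<rho>" by blast
    have "\<bar>x t j - x t i\<bar> \<le> r i" if "i \<in> {1..n}" "j \<in> {1..n}" for i j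
      using bounds[OF that(1), of t] bounds[OF that(2), of t] r[OF that(1)] t
      unfolding D_def by linarith
    then have "hk_neighbours n r (x t) i = {1..n}" if "i \<in> {1..n}" for i
      using that by (auto simp: hk_neighbours_def)
    then have "x (Suc t) j = x (Suc t) i" if "i \<in> {1..n}" "j \<in> {1..n}" for i j
      using that step by (simp add: hk_update_def)
    then show ?thesis
      using system_converges_if_frozen[OF assms(4), of "Suc t"] r unit hk_neighbours_subset
      by blast
  next
    case False
    then have D_gt: "\<rho> < D t" for t by (simp add: not_le)
    \<comment> \<open>Chosen so that \<open>d + n * (c + d) = \<rho>\<close> for clusters of width \<open>d = n * c\<close>.\<close>
    define c where "c = \<rho> / (real n * (real n + 2))"
    define d where "d = real n * c"
    have n: "real n \<ge> 1" using assms(1) by simp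
    have c_pos: "0 < c" using n \<rho>_pos by (simp add: c_def)
    have "real n * (real n + 2) \<noteq> 0" using n by simp
    then have d_eq: "d * (real n + 2) = \<rho>" by (simp add: c_def d_def)
    have cd: "d + real n * (c + d) = \<rho>"
      using d_eq by (simp add: d_def algebra_simps)
    have d_nonneg: "0 \<le> d" using n c_pos by (simp add: d_def)
    have d3: "3 * d \<le> \<rho>"
      using mult_left_mono[of 3 "real n + 2" d] n d_nonneg d_eq by linarith
    obtain T where T: "\<And>t. T \<le> t \<Longrightarrow> D t - D (Suc t) \<le> c"
      using decreasing_nonneg_eventually_small_drop[OF dec D_nonneg c_pos] by blast
    have move: "a (Suc t) \<le> a t + c" "b t - c \<le> b (Suc t)" if "T \<le> t" for t
      using T[OF that] mono[of t] unfolding D_def by linarith+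
    have polar: "polarized n (a t) (b t) d (x t)" if "T \<le> t" for t
    proof -
      obtain k l where k: "k \<in> {1..n}" "x (Suc t) k = b (Suc t)"
        and l: "l \<in> {1..n}" "x (Suc t) l = a (Suc t)"
        using attained by blast
      show ?thesis unfolding d_def
      proof (rule polarized_if_extremes_move_little[OF bounds r])
        show "b t - a t \<le> 2 * \<rho>" using D_le[of t] by (simp add: D_def)
        show "b t - c \<le> hk_update n r (x t) k" using k step[OF k(1)] move[OF that] by simp
        show "hk_update n r (x t) l \<le> a t + c" using l step[OF l(1)] move[OF that] by simp
      qed (use k l in auto)
    qed
    have polar_update: "polarized n (a (Suc t)) (b (Suc t)) d (hk_update n r (x t))"
      if "T \<le> t" for t
      using polar[of "Suc t"] that step by (simp add: polarized_def)
    have within: "hears_within n r d (x t)" if "T \<le> t" for t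
    proof (rule hears_within_if_polarized[OF polar[OF that] polar_update[OF that] move[OF that]])
      show "d + real n * (c + d) < b t - a t" using D_gt[of t] cd by (simp add: D_def)
      show "0 < r j \<and> d \<le> r j" if "j \<in> {1..n}" for j
        using r[OF that] d3 d_nonneg by linarith
    qed
    show ?thesis
    proof (rule system_converges_if_frozen[OF assms(4)])
      fix i j assume i: "i \<in> {1..n}" and j: "j \<in> hk_neighbours n r (x (Suc T)) i"
      have j': "j \<in> {1..n}" using j hk_neighbours_subset by blast
      have "j \<in> hk_neighbours n r (hk_update n r (x T)) i"
        using j step[OF i] step[OF j'] by (simp add: hk_neighbours_def)
      moreover have "hears_within n r d (hk_update n r (x T))"
        using within[of "Suc T"] step by (simp add: hears_within_def)
      moreover have "3 * d < b T - a T"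
        using d3 D_gt[of T] by (simp add: D_def)
      ultimately have "hk_update n r (x T) j = hk_update n r (x T) i"
        using frozen_after_merge[OF polar[OF order_refl] _ within[OF order_refl]] i r by blast
      then show "x (Suc T) j = x (Suc T) i"
        using step[OF i] step[OF j'] by simp
    qed (use r unit in auto)
  qed
qed

end
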